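(* Let $n>3$. For Wolfram rules $28$ and $29$ on the circular graph with $n$ vertices, the sets of periodic states are $P_{28}=N_{BCF}\cup\{\mathbf{0}\}$ and $P_{29}=N_{BCF}$; the numbers of orbits of the dynamics groups $G_{28}$ on $P_{28}$ and $G_{29}$ on $P_{29}$ are $o_{28}=|N_{AB}|+1$ and $o_{29}=|N_{AB}|$ respectively; and $G_{28}$ and $G_{29}$ are both isomorphic to $\mathbb{Z}_2^n$ when $n>4$, and are both trivial when $n=4$.
   Context: Indices are taken modulo $n$. For $1\le i\le n$, the local update function $F_i\colon\mathbb{F}_2^n\to\mathbb{F}_2^n$ changes at most the coordinate $y_i$. For Wolfram rule $28$: if $y_{i-1}=y_{i+1}=1$ then $y_i$ becomes $0$; if $y_{i-1}=1,y_{i+1}=0$ then $y_i$ becomes $1-y_i$; otherwise $y_i$ is unchanged. For Wolfram rule $29$: the same, except that additionally if $y_{i-1}=y_{i+1}=0$ then $y_i$ becomes $1$. Both rules are $\pi$-independent: for a simple update order $\pi$ (a sequence $\pi_1,\dots,\pi_n$ containing each of $1,\dots,n$ exactly once) the set of states periodic under iteration of $F_{\pi_n}\circ\cdots\circ F_{\pi_1}$ does not depend on $\pi$; this set is $P_k$ for rule $k$. The dynamics group $G_k$ is the group of permutations of $P_k$ generated by the restrictions of $F_1,\dots,F_n$ to $P_k$. $\mathbf{0}$ is the all-$0$ state. Abbreviations: $A=$`11', $B=$`000', $C=$`111', $F=$`1100'. $N_{XY\ldots}$ is the set of states in $\mathbb{F}_2^n$ containing none of the words $X,Y,\ldots$ as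 a (cyclic, contiguous) subword. $\mathbb{Z}_2=\mathbb{Z}/2\mathbb{Z}$. *)

theory Defs
  imports "HOL-Library.Z2" "HOL-Algebra.Bij" "HOL-Algebra.Group_Action"
    "HOL-Algebra.Elementary_Groups" "HOL-Algebra.Product_Groups"
begin

text \<open>
  A state in \<open>F_2^n\<close> is a list of \<open>n\<close> bits.  The vertices of the circular graph are numbered
  \<open>0, \<dots>, n - 1\<close> (instead of \<open>1, \<dots>, n\<close>), and all index arithmetic is modulo \<open>n\<close>.
\<close>

definition states :: "nat \<Rightarrow> bit list set" where
  "states n = {y. length y = n}"

text \<open>A rule maps \<open>y_{i-1}\<close>, \<open>y_i\<close>, \<open>y_{i+1}\<close> (in this order) to the new value of \<open>y_i\<close>.\<close>

type_synonym rule = "bit \<Rightarrow> bit \<Rightarrow> bit \<Rightarrow> bit"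

definition rule28 :: rule where
  "rule28 l x r = (if l = 1 \<and> r = 1 then 0 else if l = 1 \<and> r = 0 then 1 - x else x)"

definition rule29 :: rule where
  "rule29 l x r =
    (if l = 1 \<and> r = 1 then 0 else if l = 1 \<and> r = 0 then 1 - x
     else if l = 0 \<and> r = 0 then 1 else x)"

definition local_update :: "rule \<Rightarrow> nat \<Rightarrow> bit list \<Rightarrow> bit list" where
  "local_update f i y =
    (let n = length y in
     y[i := f (y ! ((i + n - 1) mod n)) (y ! i) (y ! ((i + 1) mod n))])"

definition simple_update_order :: "nat \<Rightarrow> nat list \<Rightarrow> bool" where
  "simple_update_order n \<pi> \<longleftrightarrow> distinct \<pi> \<and> set \<pi> = {..<n}"

text \<open>\<open>fold\<close> applies the updates from left to right, i.e. the first entry of \<open>\<pi>\<close> acts first.\<close>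

definition system_map :: "rule \<Rightarrow> nat list \<Rightarrow> bit list \<Rightarrow> bit list" where
  "system_map f \<pi> = fold (local_update f) \<pi>"

definition periodic_states :: "rule \<Rightarrow> nat \<Rightarrow> nat list \<Rightarrow> bit list set" where
  "periodic_states f n \<pi> = {y \<in> states n. \<exists>m>0. (system_map f \<pi> ^^ m) y = y}"

text \<open>
  The subgroup of the symmetric group on the periodic states generated by the restrictions of the
  local update functions; \<open>BijGroup\<close> represents a permutation of a set by a function that
  is \<open>undefined\<close> outside it, hence \<open>restrict\<close>.
\<close>

definition dynamics_group ::
    "rule \<Rightarrow> nat \<Rightarrow> nat list \<Rightarrow> (bit list \<Rightarrow> bit list) monoid" where
  "dynamics_group f n \<pi> =
    (let P = periodic_states f n \<pi> in
     (BijGroup P)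
       \<lparr>carrier := generate (BijGroup P) ((\<lambda>i. restrict (local_update f i) P) ` {..<n})\<rparr>)"

definition num_orbits :: "rule \<Rightarrow> nat \<Rightarrow> nat list \<Rightarrow> nat" where
  "num_orbits f n \<pi> = card (orbits (dynamics_group f n \<pi>) (periodic_states f n \<pi>) (\<lambda>g. g))"

definition cyclic_subword :: "bit list \<Rightarrow> bit list \<Rightarrow> bool" where
  "cyclic_subword w y \<longleftrightarrow>
    (\<exists>j<length y. \<forall>t<length w. y ! ((j + t) mod length y) = w ! t)"

definition avoiding :: "nat \<Rightarrow> bit list set \<Rightarrow> bit list set" where
  "avoiding n W = {y \<in> states n. \<forall>w\<in>W. \<not> cyclic_subword w y}"

abbreviation "word_A \<equiv> [1, 1 :: bit]"
abbreviation "word_B \<equiv> [0, 0, 0 :: bit]"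
abbreviation "word_C \<equiv> [1, 1, 1 :: bit]"
abbreviation "word_F \<equiv> [1, 1, 0, 0 :: bit]"

definition Z2_power :: "nat \<Rightarrow> (nat \<Rightarrow> int) monoid" where
  "Z2_power n = product_group {..<n} (\<lambda>_. integer_mod_group 2)"

end

theory Submission
  imports Defs
begin

text \<open>
  Everything is governed by the rises of a state, the places where a 0 is followed by a 1. No local
  update of either rule destroys a rise (\<open>rises_local_update_mono\<close>), so along a periodic trajectory
  the rises never change at all. The only updates left are \<open>100 \<leftrightarrow> 110\<close>, which move the end of a
  block of 1s. If two consecutive rises were at distance 4 or more, then the position after the
  first 1 of the gap would flip in every sweep, and this pushes a second 1 next to it that creates
  a new rise (\<open>no_wide_gap_aux\<close>). Hence consecutive rises are at distance 2 or 3, which says exactly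
  that none of the words \<open>000\<close>, \<open>111\<close>, \<open>1100\<close> occurs (\<open>avoiding_BCF_eq\<close>); the only other candidates
  are the constant states, of which just the zero state under rule 28 is periodic.

  A gap of width 2 reads \<open>10\<close>, a gap of width 3 reads \<open>100\<close> or \<open>110\<close>; its middle bit is called
  loose. On the states found so far, the update at \<open>i\<close> flips \<open>i\<close> if \<open>i\<close> is loose and does nothing
  otherwise (\<open>local_update_eq_toggle\<close>). Since flipping loose bits does not affect the rises, it does
  not affect which bits are loose, so the updates are commuting involutions: subsets of the vertices
  act by toggling, with symmetric difference as composition (\<open>toggle_toggle\<close>). Three consequences
  finish the proof. A sweep is a toggle, hence of order at most 2, so all these states are periodic.
  An orbit consists of all states with given rises and contains a unique one without \<open>11\<close>, namely
  the one in which every loose bit is 0; these representatives make up \<open>N_{AB}\<close>, plus the zero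
  state under rule 28. And distinct subsets act differently as soon as every vertex is loose in some state, which
  holds for \<open>n > 4\<close> (\<open>exists_loose_state\<close>), while for \<open>n = 4\<close> the rises around a loose bit would
  overlap and nothing can be toggled.
\<close>

section \<open>States as periodic bit sequences\<close>

text \<open>Integer positions make the neighbours of position \<open>k\<close> simply \<open>k - 1\<close> and \<open>k + 1\<close>.\<close>

definition bit_at :: "bit list \<Rightarrow> int \<Rightarrow> bit" where
  "bit_at y k = y ! nat (k mod int (length y))"

lemma bit_at_cong: "k mod int (length y) = k' mod int (length y) \<Longrightarrow> bit_at y k = bit_at y k'"
  by (simp add: bit_at_def)

lemma bit_at_nth: "i < length y \<Longrightarrow> bit_at y (int i) = y ! i"
  by (simp add: bit_at_def)

lemma list_eq_if_bit_at_eq: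
  assumes "length y = length z" and "\<And>k. bit_at y k = bit_at z k"
  shows "y = z"
  using assms by (metis bit_at_nth nth_equalityI)

lemma nat_mod_less:
  assumes "n > 0"
  shows "nat (k mod int n) < n" and "int (nat (k mod int n)) = k mod int n"
  using assms by (simp_all add: nat_less_iff)

lemma mod_shift_neq:
  assumes "n > 3" and "c \<noteq> 0" and "\<bar>c\<bar> \<le> 3"
  shows "(k + c) mod int n \<noteq> k mod int n"
proof
  assume "(k + c) mod int n = k mod int n"
  then have "int n dvd c"
    by (simp add: mod_eq_dvd_iff)
  then have "int n \<le> \<bar>c\<bar>"
    using assms(2) dvd_imp_le_int[of c "int n"] by simp
  then show False
    using assms by simp
qed

lemma cyclic_subword_iff:
  assumes "length y > 0"
  shows "cyclic_subword w y \<longleftrightarrow> (\<exists>k. \<forall>t<length w. bit_at y (k + int t) = w ! t)"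
proof
  assume "cyclic_subword w y"
  then obtain j where "\<forall>t<length w. y ! ((j + t) mod length y) = w ! t"
    by (auto simp: cyclic_subword_def)
  then have "\<forall>t<length w. bit_at y (int j + int t) = w ! t"
    by (simp add: bit_at_def flip: of_nat_add of_nat_mod)
  then show "\<exists>k. \<forall>t<length w. bit_at y (k + int t) = w ! t" ..
next
  assume "\<exists>k. \<forall>t<length w. bit_at y (k + int t) = w ! t"
  then obtain k where k: "\<forall>t<length w. bit_at y (k + int t) = w ! t" ..
  define j where "j = nat (k mod int (length y))"
  have j: "j < length y" "int j = k mod int (length y)"
    using nat_mod_less assms by (simp_all add: j_def)
  have "y ! ((j + t) mod length y) = bit_at y (k + int t)" for t
  proof -
    have "int ((j + t) mod length y) = (k + int t) mod int (length y)"
      by (simp add: of_nat_mod j(2) mod_add_left_eq)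
    then show ?thesis
      unfolding bit_at_def by (metis nat_int)
  qed
  then show "cyclic_subword w y"
    using j k by (auto simp: cyclic_subword_def)
qed

lemma bit_at_local_update:
  assumes "length y = n" and "i < n"
  shows "bit_at (local_update f i y) k =
    (if k mod int n = int i then f (bit_at y (k - 1)) (bit_at y k) (bit_at y (k + 1))
     else bit_at y k)"
proof (cases "k mod int n = int i")
  case True
  have "int ((i + n - 1) mod n) = (int i - 1) mod int n"
  proof -
    have "int ((i + n - 1) mod n) = (int i - 1 + int n) mod int n"
      using assms by (simp add: of_nat_mod of_nat_diff algebra_simps)
    then show ?thesis by simp
  qed
  also have "\<dots> = (k - 1) mod int n"
    using True by (metis mod_diff_left_eq)
  finally have l: "nat ((k - 1) mod int n) = (i + n - 1) mod n"
    by (metis nat_int)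
  have "int ((i + 1) mod n) = (k + 1) mod int n"
    using True by (metis mod_add_left_eq of_nat_1 of_nat_add of_nat_mod)
  then have r: "nat ((k + 1) mod int n) = (i + 1) mod n"
    by (metis nat_int)
  show ?thesis
    using assms True l r by (simp add: bit_at_def local_update_def Let_def)
next
  case False
  then have "nat (k mod int n) \<noteq> i"
    using assms nat_mod_less(2)[of n k] by (metis gr_zeroI not_less_zero)
  then show ?thesis
    using assms False by (simp add: bit_at_def local_update_def Let_def)
qed

lemma length_local_update [simp]: "length (local_update f i y) = length y"
  by (simp add: local_update_def Let_def)


section \<open>Rises, and the states in which they are dense\<close>

definition rises :: "bit list \<Rightarrow> int set" where
  "rises y = {k. bit_at y k = 0 \<and> bit_at y (k + 1) = 1}"

definition spaced :: "bit list \<Rightarrow> bool" where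
  "spaced y \<longleftrightarrow> (\<forall>k. k \<in> rises y \<or> k + 1 \<in> rises y \<or> k + 2 \<in> rises y)"

lemma rises_cong:
  "k mod int (length y) = k' mod int (length y) \<Longrightarrow> k \<in> rises y \<longleftrightarrow> k' \<in> rises y"
  using bit_at_cong[of k y k'] bit_at_cong[of "k + 1" y "k' + 1"] mod_add_cong[of k _ k' 1 1]
  by (simp add: rises_def)

lemma not_cyclic_subword_A_iff:
  assumes "length y > 0"
  shows "\<not> cyclic_subword word_A y \<longleftrightarrow> (\<forall>k. bit_at y k = 1 \<longrightarrow> bit_at y (k + 1) = 0)"
  using assms by (auto simp: cyclic_subword_iff All_less_Suc numeral_eq_Suc)

lemma cyclic_subword_prefix: "cyclic_subword (u @ v) y \<Longrightarrow> cyclic_subword u y"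
  unfolding cyclic_subword_def by (metis length_append nth_append trans_less_add1)

text \<open>Without \<open>11\<close> every 1 ends a rise, so the rises determine the state.\<close>

lemma eq_if_rises_eq_no_A:
  assumes "length y = length z" "length y > 0" "rises y = rises z"
    and "\<not> cyclic_subword word_A y" "\<not> cyclic_subword word_A z"
  shows "y = z"
proof (rule list_eq_if_bit_at_eq)
  fix k
  have "bit_at x k = 1 \<longleftrightarrow> k - 1 \<in> rises x" if "length x > 0" "\<not> cyclic_subword word_A x" for x
    using that(2)[unfolded not_cyclic_subword_A_iff[OF that(1)], rule_format, of "k - 1"]
    by (cases "bit_at x (k - 1)") (auto simp: rises_def)
  from this[of y] this[of z] have "bit_at y k = 1 \<longleftrightarrow> bit_at z k = 1"
    using assms by simp
  then show "bit_at y k = bit_at z k"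
    by (cases "bit_at y k"; cases "bit_at z k") auto
qed (use assms in simp)

text \<open>Four consecutive bits without a rise are non-increasing, so they are one of \<open>0000\<close>,
  \<open>1000\<close>, \<open>1100\<close>, \<open>1110\<close>, \<open>1111\<close>; each of these contains \<open>000\<close>, \<open>111\<close> or \<open>1100\<close>.\<close>

lemma avoiding_BCF_eq:
  assumes "n > 0"
  shows "avoiding n {word_B, word_C, word_F} = {y \<in> states n. spaced y}"
proof -
  have "(\<forall>w\<in>{word_B, word_C, word_F}. \<not> cyclic_subword w y) \<longleftrightarrow> spaced y" if "length y = n" for y
  proof -
    let ?b = "bit_at y"
    have "cyclic_subword word_B y \<longleftrightarrow> (\<exists>k. ?b k = 0 \<and> ?b (k+1) = 0 \<and> ?b (k+2) = 0)"
      "cyclic_subword word_C y \<longleftrightarrow> (\<exists>k. ?b k = 1 \<and> ?b (k+1) = 1 \<and> ?b (k+2) = 1)"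
      "cyclic_subword word_F y \<longleftrightarrow> (\<exists>k. ?b k = 1 \<and> ?b (k+1) = 1 \<and> ?b (k+2) = 0 \<and> ?b (k+3) = 0)"
      using that assms
      by (simp_all add: cyclic_subword_iff All_less_Suc numeral_eq_Suc conj_ac)
    note words = this
    have rise: "k \<in> rises y \<longleftrightarrow> ?b k = 0 \<and> ?b (k+1) = 1" for k
      by (simp add: rises_def)
    show ?thesis
    proof
      assume av: "\<forall>w\<in>{word_B, word_C, word_F}. \<not> cyclic_subword w y"
      show "spaced y"
        unfolding spaced_def
      proof
        fix k :: int
        have "\<not> (?b k = 0 \<and> ?b (k+1) = 0 \<and> ?b (k+2) = 0)"
          "\<not> (?b (k+1) = 0 \<and> ?b (k+1+1) = 0 \<and> ?b (k+1+2) = 0)"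
          "\<not> (?b k = 1 \<and> ?b (k+1) = 1 \<and> ?b (k+2) = 1)"
          "\<not> (?b k = 1 \<and> ?b (k+1) = 1 \<and> ?b (k+2) = 0 \<and> ?b (k+3) = 0)"
          using av words by blast+
        then show "k \<in> rises y \<or> k + 1 \<in> rises y \<or> k + 2 \<in> rises y"
          unfolding rise
          by (cases "?b k"; cases "?b (k+1)"; cases "?b (k+2)"; cases "?b (k+3)"; simp add: add.commute)
      qed
    next
      assume sp: "spaced y"
      have *: "?b k = 0 \<and> ?b (k+1) = 1 \<or> ?b (k+1) = 0 \<and> ?b (k+2) = 1 \<or> ?b (k+2) = 0 \<and> ?b (k+3) = 1"
        for k using sp[unfolded spaced_def rise, rule_format, of k] by (simp add: add.assoc)
      have "\<not> cyclic_subword word_F y"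
        using * unfolding words by (metis zero_neq_one)
      moreover have "\<not> cyclic_subword word_B y" "\<not> cyclic_subword word_C y"
        unfolding words
        \<comment> \<open>The window that starts one position before the word has no rise.\<close>
        subgoal
        proof clarify
          fix k assume "?b k = 0" "?b (k+1) = 0" "?b (k+2) = 0"
          then show False using *[of "k - 1"] by (simp add: algebra_simps)
        qed
        subgoal
        proof clarify
          fix k assume "?b k = 1" "?b (k+1) = 1" "?b (k+2) = 1"
          then show False using *[of k] by simp
        qed
        done
      ultimately show "\<forall>w\<in>{word_B, word_C, word_F}. \<not> cyclic_subword w y"
        by blast
    qed
  qed
  then show ?thesis
    by (auto simp: avoiding_def states_def)
qed


text \<open>Walking to the right from one rise reaches every position, up to a multiple of the
  length.\<close>

lemma spaced_if_next_rise:
  assumes "length y > 0" and "x \<in> rises y"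
    and next_rise: "\<And>k. k \<in> rises y \<Longrightarrow> k + 1 \<in> rises y \<or> k + 2 \<in> rises y \<or> k + 3 \<in> rises y"
  shows "spaced y"
  unfolding spaced_def
proof
  fix k
  let ?N = "int (length y)"
  let ?W = "\<lambda>k. k \<in> rises y \<or> k + 1 \<in> rises y \<or> k + 2 \<in> rises y"
  have right: "?W j" if "x \<le> j" for j
    using that
  proof (induction j rule: int_ge_induct)
    case (step j)
    then show ?case
      using next_rise[of j] by (auto simp: add.assoc)
  qed (use assms in blast)
  define m where "m = \<bar>x - k\<bar>"
  have "1 * m \<le> ?N * m"
    using assms(1) by (intro mult_right_mono) (simp_all add: m_def Suc_le_eq)
  then have "x \<le> k + ?N * m"
    by (simp add: m_def)
  moreover have "k + ?N * m + c \<in> rises y \<longleftrightarrow> k + c \<in> rises y" for c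
  proof (rule rises_cong)
    have "k + ?N * m + c = k + c + ?N * m" by simp
    then show "(k + ?N * m + c) mod ?N = (k + c) mod ?N"
      by (simp only: mod_mult_self2)
  qed
  from this[of 0] this[of 1] this[of 2]
  have "?W (k + ?N * m) \<longleftrightarrow> ?W k" by simp
  ultimately show "?W k"
    using right by blast
qed

lemma bit_at_replicate [simp]: "n > 0 \<Longrightarrow> bit_at (replicate n c) k = c"
  by (simp add: bit_at_def nat_mod_less)

lemma rises_replicate [simp]: "n > 0 \<Longrightarrow> rises (replicate n c) = {}"
  by (auto simp: rises_def)

lemma constant_if_no_rises:
  assumes "rises y = {}"
  shows "y = replicate (length y) 0 \<or> y = replicate (length y) 1"
proof (cases "\<exists>i<length y. y ! i = 0")
  case True
  then obtain i where i: "i < length y" "y ! i = 0" by blast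
  have "bit_at y j = 0" if "int i \<le> j" for j
    using that
  proof (induction j rule: int_ge_induct)
    case base
    then show ?case using i by (simp add: bit_at_nth)
  next
    case (step j)
    moreover have "j \<notin> rises y"
      using assms by simp
    ultimately show ?case
      by (simp add: rises_def)
  qed
  note zero = this
  have "y ! j = 0" if "j < length y" for j
  proof -
    have "bit_at y (int j + int (length y)) = 0"
      using i that by (intro zero) simp
    moreover have "bit_at y (int j + int (length y)) = bit_at y (int j)"
      by (rule bit_at_cong) simp
    ultimately show ?thesis
      using that by (simp add: bit_at_nth)
  qed
  then show ?thesis
    by (simp add: list_eq_iff_nth_eq)
next
  case False
  then show ?thesis
    by (auto simp: list_eq_iff_nth_eq)
qed

section \<open>Toggling the loose positions\<close>

text \<open>Position \<open>k\<close> is the \<open>x\<close> in an occurrence of \<open>01x01\<close>. Expressing this by rises makes it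
  evident that it depends on the rises only.\<close>

definition loose :: "bit list \<Rightarrow> int \<Rightarrow> bool" where
  "loose y k \<longleftrightarrow> k - 2 \<in> rises y \<and> k + 1 \<in> rises y"

definition toggle :: "nat set \<Rightarrow> bit list \<Rightarrow> bit list" where
  "toggle S y =
    map (\<lambda>i. if i \<in> S \<and> loose y (int i) then 1 - y ! i else y ! i) [0..<length y]"

lemma length_toggle [simp]: "length (toggle S y) = length y"
  by (simp add: toggle_def)

lemma loose_cong:
  "k mod int (length y) = k' mod int (length y) \<Longrightarrow> loose y k \<longleftrightarrow> loose y k'"
  unfolding loose_def
  using rises_cong[of "k - 2" y "k' - 2"] rises_cong[of "k + 1" y "k' + 1"]
    mod_add_cong[of k _ k' 1 1] mod_diff_cong[of k _ k' 2 2] by blast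

lemma bit_at_toggle:
  assumes "length y > 0"
  shows "bit_at (toggle S y) k =
    (if nat (k mod int (length y)) \<in> S \<and> loose y k then 1 - bit_at y k else bit_at y k)"
proof -
  let ?i = "nat (k mod int (length y))"
  have "loose y (int ?i) \<longleftrightarrow> loose y k"
    using nat_mod_less(2)[OF assms] by (intro loose_cong) simp
  then show ?thesis
    using nat_mod_less(1)[OF assms, of k] by (simp add: bit_at_def toggle_def)
qed

lemma looseD:
  assumes "loose y k"
  shows "bit_at y (k - 2) = 0" "bit_at y (k - 1) = 1" "bit_at y (k + 1) = 0" "bit_at y (k + 2) = 1"
  using assms by (auto simp: loose_def rises_def add.assoc)

text \<open>Neighbours are never both loose, so a toggled bit always sits between an untouched 1 on its
  left and an untouched 0 on its right, and neither of its values takes part in a rise.\<close>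

lemma rises_toggle [simp]:
  assumes "length y > 0"
  shows "rises (toggle S y) = rises y"
proof -
  have "k \<in> rises (toggle S y) \<longleftrightarrow> k \<in> rises y" for k
  proof -
    consider "loose y k" | "loose y (k + 1)" | "\<not> loose y k" "\<not> loose y (k + 1)" by blast
    then show ?thesis
    proof cases
      case 1
      then have "\<not> loose y (k + 1)"
        using looseD(4)[of y k] looseD(3)[of y "k + 1"] by (auto simp: add.assoc)
      then show ?thesis
        using looseD(3)[OF 1] assms by (simp add: rises_def bit_at_toggle)
    next
      case 2
      then have "\<not> loose y k"
        using looseD(4)[of y k] looseD(3)[of y "k + 1"] by (auto simp: add.assoc)
      then show ?thesis
        using looseD(2)[OF 2] assms by (simp add: rises_def bit_at_toggle)
    qed (use assms in \<open>simp add: rises_def bit_at_toggle\<close>)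
  qed
  then show ?thesis by blast
qed

lemma loose_toggle [simp]: "length y > 0 \<Longrightarrow> loose (toggle S y) k \<longleftrightarrow> loose y k"
  by (simp add: loose_def)

lemma spaced_toggle [simp]: "length y > 0 \<Longrightarrow> spaced (toggle S y) \<longleftrightarrow> spaced y"
  by (simp add: spaced_def)

lemma bit_one_plus_one_plus [simp]: "1 + (1 + x) = (x :: bit)"
  by (cases x) simp_all

text \<open>Both toggles see the same loose positions.\<close>

lemma toggle_toggle:
  assumes "length y > 0"
  shows "toggle S (toggle T y) = toggle (sym_diff S T) y"
  using assms by (intro list_eq_if_bit_at_eq) (auto simp: bit_at_toggle)

lemma toggle_empty [simp]: "toggle {} y = y"
  by (simp add: toggle_def map_nth)

lemma toggle_no_loose: "(\<And>k. \<not> loose y k) \<Longrightarrow> toggle S y = y"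
  by (simp add: toggle_def map_nth)

lemma toggle_no_rises: "rises y = {} \<Longrightarrow> toggle S y = y"
  by (rule toggle_no_loose) (simp add: loose_def)

section \<open>Periodic states have dense rises\<close>

locale rule_28_or_29 =
  fixes f :: rule and n :: nat
  assumes rule: "f = rule28 \<or> f = rule29" and n_gt_3: "n > 3"
begin

lemma rule_values:
  "f l 0 1 = 0" "f 0 1 r = 1" "f 1 x 1 = 0" "f 1 0 0 = 1" "f 1 1 0 = 0"
  using rule by (cases l; cases r; auto simp: rule28_def rule29_def)+

text \<open>The updates \<open>111 \<rightarrow> 101\<close> and \<open>000 \<rightarrow> 010\<close> create a rise, while \<open>100 \<leftrightarrow> 110\<close> moves a
  descent and leaves the rises alone.\<close>

lemma rises_local_update_mono:
  assumes "length y = n" and "i < n"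
  shows "rises y \<subseteq> rises (local_update f i y)"
proof
  fix k assume "k \<in> rises y"
  moreover have "(k + 1) mod int n \<noteq> k mod int n"
    using mod_shift_neq[OF n_gt_3, of 1 k] by simp
  ultimately show "k \<in> rises (local_update f i y)"
    using assms by (simp add: rises_def bit_at_local_update rule_values)
qed

lemma length_system_map [simp]: "length (system_map f \<sigma> z) = length z"
  unfolding system_map_def by (induction \<sigma> arbitrary: z) simp_all

lemma system_map_simps [simp]:
  "system_map f [] z = z"
  "system_map f (i # \<sigma>) z = system_map f \<sigma> (local_update f i z)"
  "system_map f (\<sigma> @ \<tau>) z = system_map f \<tau> (system_map f \<sigma> z)"
  by (simp_all add: system_map_def)

lemma rises_system_map_mono:
  assumes "length z = n" and "set \<sigma> \<subseteq> {..<n}"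
  shows "rises z \<subseteq> rises (system_map f \<sigma> z)"
  using assms
proof (induction \<sigma> arbitrary: z)
  case (Cons i \<sigma>)
  have "rises z \<subseteq> rises (local_update f i z)"
    using Cons.prems by (intro rises_local_update_mono) auto
  also have "\<dots> \<subseteq> rises (system_map f \<sigma> (local_update f i z))"
    using Cons.prems by (intro Cons.IH) auto
  finally show ?case by simp
qed simp

lemma bit_at_system_map_unchanged:
  assumes "length z = n" and "set \<sigma> \<subseteq> {..<n}" and "nat (k mod int n) \<notin> set \<sigma>"
  shows "bit_at (system_map f \<sigma> z) k = bit_at z k"
  using assms
proof (induction \<sigma> arbitrary: z)
  case (Cons i \<sigma>)
  then show ?case
    by (auto simp: bit_at_local_update)
qed simp

definition periodic :: "nat list \<Rightarrow> bit list \<Rightarrow> bool" where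
  "periodic \<sigma> z \<longleftrightarrow>
    length z = n \<and> set \<sigma> \<subseteq> {..<n} \<and> (\<exists>m>0. (system_map f \<sigma> ^^ m) z = z)"

text \<open>Since rises never disappear, they are constant along a periodic trajectory, also in the
  middle of a sweep.\<close>

lemma rises_periodic:
  assumes "periodic (\<sigma> @ \<tau>) z"
  shows "rises (system_map f \<sigma> z) = rises z"
proof
  define S where "S = system_map f (\<sigma> @ \<tau>)"
  have S: "length (S w) = length w" "S w = system_map f \<tau> (system_map f \<sigma> w)" for w
    by (simp_all add: S_def)
  have z: "length z = n" "set \<sigma> \<subseteq> {..<n}" "set \<tau> \<subseteq> {..<n}"
    using assms by (auto simp: periodic_def)
  obtain m where "m > 0" and m: "(S ^^ m) z = z"
    using assms by (auto simp: periodic_def S_def)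
  then obtain m' where m': "m = Suc m'"
    by (cases m) auto
  have iterate: "length ((S ^^ j) w) = n \<and> rises w \<subseteq> rises ((S ^^ j) w)" if "length w = n" for w j
  proof (induction j)
    case (Suc j)
    moreover have "rises ((S ^^ j) w) \<subseteq> rises (S ((S ^^ j) w))"
      using rises_system_map_mono[of "(S ^^ j) w" "\<sigma> @ \<tau>", folded S_def] Suc z by simp
    ultimately show ?case by (auto simp: S(1))
  qed (use that in simp)
  show "rises z \<subseteq> rises (system_map f \<sigma> z)"
    using z by (intro rises_system_map_mono)
  have "rises (system_map f \<sigma> z) \<subseteq> rises (S z)"
    using z by (simp add: S(2) rises_system_map_mono)
  also have "\<dots> \<subseteq> rises ((S ^^ m') (S z))"
    using iterate[of "S z" m'] z by (simp add: S(1))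
  also have "(S ^^ m') (S z) = z"
    using m m' by (simp only: funpow_Suc_right o_apply)
  finally show "rises (system_map f \<sigma> z) \<subseteq> rises z" .
qed

lemma periodic_rotate:
  assumes "periodic (\<sigma> @ \<tau>) z"
  shows "periodic (\<tau> @ \<sigma>) (system_map f \<sigma> z)"
proof -
  have "(system_map f (\<tau> @ \<sigma>) ^^ m) (system_map f \<sigma> z)
      = system_map f \<sigma> ((system_map f (\<sigma> @ \<tau>) ^^ m) z)" for m
    by (induction m) simp_all
  then show ?thesis
    using assms by (fastforce simp: periodic_def)
qed

lemma periodic_sweep:
  assumes "periodic \<sigma> z"
  shows "periodic \<sigma> (system_map f \<sigma> z)" and "rises (system_map f \<sigma> z) = rises z"
  using periodic_rotate[of \<sigma> "[]" z] rises_periodic[of \<sigma> "[]" z] assms by simp_all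

text \<open>Otherwise the update at \<open>k\<close> would be \<open>111 \<rightarrow> 101\<close> and create a rise.\<close>

lemma periodic_right_neighbour_0:
  assumes "periodic (p # \<rho>) w" and "k mod int n = int p"
    and "k - 2 \<in> rises w" and "k \<notin> rises w"
  shows "bit_at w (k + 1) = 0"
proof (rule ccontr)
  assume "\<not> ?thesis"
  then have "bit_at w (k + 1) = 1" by simp
  moreover have "bit_at w k = 1" and "bit_at w (k - 1) = 1"
    using assms calculation by (auto simp: rises_def)
  moreover have "(k + 1) mod int n \<noteq> k mod int n"
    using mod_shift_neq[OF n_gt_3, of 1 k] by simp
  moreover have "length w = n" "p < n"
    using assms(1) by (auto simp: periodic_def)
  ultimately have "k \<in> rises (local_update f p w)"
    using assms(2) by (simp add: rises_def bit_at_local_update rule_values)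
  moreover have "rises (local_update f p w) = rises w"
    using rises_periodic[of "[p]" \<rho> w] assms(1) by simp
  ultimately show False
    using assms(4) by simp
qed

text \<open>The sweep is rotated so that it starts at \<open>k\<close>. There is a 1 at \<open>k - 1\<close>, and the previous lemma
  puts a 0 at \<open>k + 1\<close> at the start of every sweep, so \<open>k\<close> flips in every sweep. Take a sweep in
  which it becomes 1. When position \<open>k + 1\<close> is updated later in that sweep, its neighbours are 1 and
  0, because the gap is so wide that \<open>k + 2\<close> is not yet behind the next rise. So \<open>k + 1\<close> becomes 1
  and still is at the start of the next sweep, a contradiction.\<close>

lemma no_wide_gap_aux:
  assumes per: "periodic (p # \<rho>) z" and order: "simple_update_order n (p # \<rho>)"
    and k: "k mod int n = int p" and rise: "k - 2 \<in> rises z"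
    and gap: "k - 1 \<notin> rises z" "k \<notin> rises z" "k + 1 \<notin> rises z"
  shows False
proof -
  have ord: "p < n" "set \<rho> \<subseteq> {..<n}" "p \<notin> set \<rho>" "distinct \<rho>" "set (p # \<rho>) = {..<n}"
    using order by (auto simp: simple_update_order_def)
  have np: "nat (k mod int n) = p"
    using k by simp
  have shift: "(k + 1) mod int n \<noteq> k mod int n"
    using mod_shift_neq[OF n_gt_3, of 1 k] by simp
  define q where "q = nat ((k + 1) mod int n)"
  have q: "q < n" "int q = (k + 1) mod int n"
    using nat_mod_less n_gt_3 by (simp_all add: q_def)
  then have "q \<noteq> p"
    using shift k by auto
  then have "q \<in> set \<rho>"
    using q ord by auto
  then obtain \<sigma> \<tau> where \<rho>: "\<rho> = \<sigma> @ q # \<tau>"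
    by (meson split_list)
  have len: "length z = n"
    using per by (simp add: periodic_def)
  \<comment> \<open>If the bit at \<open>k\<close> is 1, this sweep clears it and the next sweep starts with a 0.\<close>
  obtain w where w: "periodic (p # \<rho>) w" "rises w = rises z" "bit_at w k = 0"
  proof (cases "bit_at z k = 0")
    case True
    then show ?thesis
      using that per by blast
  next
    case False
    have "bit_at z (k - 1) = 1" "bit_at z k = 1" "bit_at z (k + 1) = 0"
      using rise False periodic_right_neighbour_0[OF per k rise gap(2)] by (auto simp: rises_def)
    then have "bit_at (local_update f p z) k = 0"
      using k ord len by (simp add: bit_at_local_update rule_values)
    then have "bit_at (system_map f (p # \<rho>) z) k = 0"
      using bit_at_system_map_unchanged[of "local_update f p z" \<rho> k] np ord len by simp
    then show ?thesis
      using that[OF periodic_sweep[OF per]] by blast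
  qed
  have lenw: "length w = n"
    using w(1) by (simp add: periodic_def)
  have "k - 2 \<in> rises w" "k \<notin> rises w"
    using rise gap w(2) by simp_all
  then have "bit_at w (k - 1) = 1" "bit_at w (k + 1) = 0"
    using periodic_right_neighbour_0[OF w(1) k] by (auto simp: rises_def)
  define w1 where "w1 = local_update f p w"
  have w1: "length w1 = n" "bit_at w1 k = 1" "bit_at w1 (k + 1) = 0"
    using \<open>bit_at w (k - 1) = 1\<close> \<open>bit_at w (k + 1) = 0\<close> w(3) k shift ord lenw
    by (simp_all add: w1_def bit_at_local_update rule_values)
  define w2 where "w2 = system_map f \<sigma> w1"
  have w2: "length w2 = n" "bit_at w2 k = 1" "bit_at w2 (k + 1) = 0"
    using w1 bit_at_system_map_unchanged[of w1 \<sigma>] ord q_def np \<rho> by (auto simp: w2_def)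
  have "rises w2 = rises z"
    using rises_periodic[of "p # \<sigma>" "q # \<tau>" w] w \<rho> by (simp add: w2_def w1_def)
  then have "k + 1 \<notin> rises w2"
    using gap(3) by simp
  then have "bit_at w2 (k + 2) = 0"
    using w2(3) by (auto simp: rises_def add.assoc)
  then have "bit_at (local_update f q w2) (k + 1) = 1"
    using w2 q by (simp add: bit_at_local_update rule_values add.assoc)
  then have "bit_at (system_map f (p # \<rho>) w) (k + 1) = 1"
    using bit_at_system_map_unchanged[of "local_update f q w2" \<tau> "k + 1"] ord \<rho> q_def w2(1)
    by (simp add: w2_def w1_def)
  moreover have "bit_at (system_map f (p # \<rho>) w) (k + 1) = 0"
    using periodic_sweep[OF w(1)] w(2) rise gap(2) k by (intro periodic_right_neighbour_0) simp_all
  ultimately show False by simp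
qed

lemma periodic_next_rise:
  assumes "periodic \<pi> y" and "simple_update_order n \<pi>" and "k \<in> rises y"
  shows "k + 1 \<in> rises y \<or> k + 2 \<in> rises y \<or> k + 3 \<in> rises y"
proof (rule ccontr)
  assume gap: "\<not> ?thesis"
  define p where "p = nat ((k + 2) mod int n)"
  have p: "p < n" "(k + 2) mod int n = int p"
    using nat_mod_less[of n "k + 2"] n_gt_3 by (simp_all add: p_def)
  then have "p \<in> set \<pi>"
    using assms(2) by (simp add: simple_update_order_def)
  then obtain \<sigma> \<tau> where \<pi>: "\<pi> = \<sigma> @ p # \<tau>"
    by (meson split_list)
  have "periodic (p # (\<tau> @ \<sigma>)) (system_map f \<sigma> y)"
    using periodic_rotate[of \<sigma> "p # \<tau>" y] assms(1) \<pi> by simp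
  moreover have "simple_update_order n (p # (\<tau> @ \<sigma>))"
    using assms(2) \<pi> by (auto simp: simple_update_order_def)
  moreover have "rises (system_map f \<sigma> y) = rises y"
    using rises_periodic assms(1) \<pi> by simp
  moreover have "k + 2 + 1 = k + 3" "k + 2 - 1 = k + 1" "k + 2 - 2 = k"
    by simp_all
  ultimately show False
    using no_wide_gap_aux[of p "\<tau> @ \<sigma>" "system_map f \<sigma> y" "k + 2"] p(2) assms(3) gap by metis
qed

text \<open>Until \<open>periodic_states_eq_recurrent\<close> these are merely the candidates for periodic
  states.\<close>

definition recurrent :: "bit list set" where
  "recurrent = {y \<in> states n. spaced y \<or> y = replicate n 0 \<and> f = rule28}"

text \<open>Without rises the state is constant; an update of the all-1 state creates a rise, and under
  rule 29 so does an update of the zero state.\<close>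

lemma periodic_imp_recurrent:
  assumes per: "periodic \<pi> y" and order: "simple_update_order n \<pi>"
  shows "y \<in> recurrent"
proof (cases "rises y = {}")
  case False
  then obtain x where "x \<in> rises y" by blast
  moreover have "length y > 0"
    using per n_gt_3 by (simp add: periodic_def)
  ultimately have "spaced y"
    using periodic_next_rise[OF per order] spaced_if_next_rise by metis
  then show ?thesis
    using per by (simp add: recurrent_def periodic_def states_def)
next
  case True
  have len: "length y = n"
    using per by (simp add: periodic_def)
  have "0 \<in> set \<pi>"
    using order n_gt_3 by (simp add: simple_update_order_def)
  then obtain i \<sigma> where \<pi>: "\<pi> = i # \<sigma>"
    by (cases \<pi>) auto
  have "i \<in> set \<pi>"
    using \<pi> by simp
  then have i: "i < n" "int i mod int n = int i"
    using order by (simp_all add: simple_update_order_def)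
  have no_rise: "rises (local_update f i y) = {}"
    using rises_periodic[of "[i]" \<sigma> y] per True \<pi> by simp
  have right: "(int i + 1) mod int n \<noteq> int i" and left: "(int i - 1) mod int n \<noteq> int i"
    using mod_shift_neq[OF n_gt_3, of 1 "int i"] mod_shift_neq[OF n_gt_3, of "-1" "int i"] i
    by simp_all
  have "y \<noteq> replicate n 1"
  proof
    assume "y = replicate n 1"
    then have "int i \<in> rises (local_update f i y)"
      using i right n_gt_3 by (simp add: rises_def bit_at_local_update rule_values)
    then show False using no_rise by simp
  qed
  then have y: "y = replicate n 0"
    using constant_if_no_rises[OF True] len by auto
  have "f = rule28"
  proof (rule ccontr)
    assume "f \<noteq> rule28"
    then have "f 0 0 0 = 1"
      using rule by (auto simp: rule29_def)
    then have "int i - 1 \<in> rises (local_update f i y)"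
      using i left n_gt_3 y by (simp add: rises_def bit_at_local_update)
    then show False using no_rise by simp
  qed
  then show ?thesis
    unfolding recurrent_def states_def using y by simp
qed

text \<open>Since gaps have width 2 or 3, the neighbourhood \<open>1x0\<close> occurs only inside \<open>01x01\<close>, while \<open>111\<close>
  and \<open>000\<close> do not occur. The zero state has no loose position and is fixed by rule 28.\<close>

lemma local_update_eq_toggle:
  assumes "y \<in> recurrent" and "i < n"
  shows "local_update f i y = toggle {i} y"
proof (cases "spaced y")
  case False
  then have y: "y = replicate n 0" "f = rule28"
    using assms(1) by (auto simp: recurrent_def)
  then have "rises y = {}"
    using n_gt_3 by simp
  then have "toggle {i} y = y"
    by (rule toggle_no_rises)
  moreover have "local_update f i y = y"
    using y assms(2) n_gt_3
    by (intro list_eq_if_bit_at_eq) (simp_all add: bit_at_local_update rule28_def)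
  ultimately show ?thesis by simp
next
  case True
  have len: "length y = n"
    using assms(1) by (simp add: recurrent_def states_def)
  show ?thesis
  proof (rule list_eq_if_bit_at_eq)
    fix k
    let ?b = "bit_at y"
    show "bit_at (local_update f i y) k = bit_at (toggle {i} y) k"
    proof (cases "k mod int n = int i")
      case False
      then have "nat (k mod int n) \<noteq> i"
        using nat_mod_less(2)[of n k] n_gt_3 by auto
      then show ?thesis
        using False assms(2) len n_gt_3 by (simp add: bit_at_local_update bit_at_toggle)
    next
      case k: True
      have win: "?b (k-2) = 0 \<and> ?b (k-1) = 1 \<or> ?b (k-1) = 0 \<and> ?b k = 1 \<or> ?b k = 0 \<and> ?b (k+1) = 1"
        "?b (k-1) = 0 \<and> ?b k = 1 \<or> ?b k = 0 \<and> ?b (k+1) = 1 \<or> ?b (k+1) = 0 \<and> ?b (k+2) = 1"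
        using True[unfolded spaced_def, rule_format, of "k - 2"]
          True[unfolded spaced_def, rule_format, of "k - 1"]
        by (simp_all add: rises_def algebra_simps)
      have loose: "loose y k \<longleftrightarrow> ?b (k-2) = 0 \<and> ?b (k-1) = 1 \<and> ?b (k+1) = 0 \<and> ?b (k+2) = 1"
        by (simp add: loose_def rises_def add.assoc)
      have "f (?b (k-1)) (?b k) (?b (k+1)) = (if loose y k then 1 - ?b k else ?b k)"
        using win unfolding loose
        by (cases "?b (k-2)"; cases "?b (k-1)"; cases "?b k"; cases "?b (k+1)"; cases "?b (k+2)";
            simp add: rule_values)
      then show ?thesis
        using k assms(2) len n_gt_3 by (simp add: bit_at_local_update bit_at_toggle)
    qed
  qed simp
qed

lemma length_recurrent: "y \<in> recurrent \<Longrightarrow> length y = n \<and> length y > 0"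
  using n_gt_3 by (auto simp: recurrent_def states_def)

lemma toggle_recurrent:
  assumes "y \<in> recurrent"
  shows "toggle S y \<in> recurrent"
proof (cases "spaced y")
  case True
  then show ?thesis
    using assms length_recurrent[OF assms] n_gt_3 by (simp add: recurrent_def states_def)
next
  case False
  then have "rises y = {}"
    using assms n_gt_3 by (auto simp: recurrent_def)
  then show ?thesis
    using assms by (simp add: toggle_no_rises)
qed

text \<open>The same set serves all states; therefore two sweeps cancel.\<close>

lemma system_map_eq_toggle:
  assumes "set \<sigma> \<subseteq> {..<n}"
  shows "\<exists>S. \<forall>y\<in>recurrent. system_map f \<sigma> y = toggle S y"
  using assms
proof (induction \<sigma>)
  case (Cons i \<sigma>)
  then obtain S where S: "\<forall>y\<in>recurrent. system_map f \<sigma> y = toggle S y"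
    by auto
  have "system_map f (i # \<sigma>) y = toggle (sym_diff S {i}) y" if "y \<in> recurrent" for y
    using S that Cons.prems toggle_recurrent[OF that] length_recurrent[OF that]
    by (simp add: local_update_eq_toggle toggle_toggle)
  then show ?case by blast
qed (auto intro: exI[of _ "{}"])

lemma periodic_states_eq_recurrent:
  assumes "simple_update_order n \<pi>"
  shows "periodic_states f n \<pi> = recurrent"
proof
  have set: "set \<pi> = {..<n}"
    using assms by (simp add: simple_update_order_def)
  show "periodic_states f n \<pi> \<subseteq> recurrent"
    using periodic_imp_recurrent[OF _ assms] set
    by (auto simp: periodic_states_def periodic_def states_def)
  show "recurrent \<subseteq> periodic_states f n \<pi>"
  proof
    fix y assume y: "y \<in> recurrent"
    obtain S where S: "\<forall>y\<in>recurrent. system_map f \<pi> y = toggle S y"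
      using system_map_eq_toggle set by blast
    have "(system_map f \<pi> ^^ 2) y = toggle S (toggle S y)"
      using S y toggle_recurrent by (simp add: numeral_2_eq_2)
    also have "\<dots> = y"
      using toggle_toggle length_recurrent[OF y] by simp
    finally show "y \<in> periodic_states f n \<pi>"
      using length_recurrent[OF y] by (auto simp: periodic_states_def states_def intro!: exI[of _ 2])
  qed
qed



section \<open>The dynamics group\<close>

definition perm :: "nat set \<Rightarrow> bit list \<Rightarrow> bit list" where
  "perm S = restrict (toggle S) recurrent"

lemma perm_perm: "y \<in> recurrent \<Longrightarrow> perm S (perm T y) = perm (sym_diff S T) y"
  using toggle_recurrent[of y T] length_recurrent[of y] n_gt_3 by (simp add: perm_def toggle_toggle)

lemma perm_empty: "perm {} = (\<lambda>y\<in>recurrent. y)"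
  by (simp add: perm_def restrict_def fun_eq_iff)

lemma perm_in_Bij: "perm S \<in> Bij recurrent"
proof -
  have "perm S (perm S y) = y" if "y \<in> recurrent" for y
    using that by (simp add: perm_perm perm_empty)
  moreover have "perm S y \<in> recurrent" if "y \<in> recurrent" for y
    using that by (simp add: perm_def toggle_recurrent)
  ultimately have "bij_betw (perm S) recurrent recurrent"
    by (intro bij_betw_byWitness[where f' = "perm S"]) auto
  then show ?thesis
    by (simp add: Bij_def perm_def)
qed

lemma perm_mult: "perm S \<otimes>\<^bsub>BijGroup recurrent\<^esub> perm T = perm (sym_diff S T)"
proof -
  have "compose recurrent (perm S) (perm T) = perm (sym_diff S T)"
  proof
    fix y
    show "compose recurrent (perm S) (perm T) y = perm (sym_diff S T) y"
      by (cases "y \<in> recurrent") (simp_all add: compose_def perm_perm, simp add: perm_def)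
  qed
  then show ?thesis
    using perm_in_Bij by (simp add: BijGroup_def)
qed

lemma perm_one: "\<one>\<^bsub>BijGroup recurrent\<^esub> = perm {}"
  by (simp add: BijGroup_def perm_empty)

lemma perm_inv: "inv\<^bsub>BijGroup recurrent\<^esub> (perm S) = perm S"
  by (rule group.inv_equality[OF group_BijGroup])
    (simp_all add: perm_mult perm_one, simp_all add: BijGroup_def perm_in_Bij)

lemma generate_perm:
  "generate (BijGroup recurrent) ((\<lambda>i. perm {i}) ` {..<n}) = perm ` Pow {..<n}"
    (is "generate ?B ?H = _")
proof
  show "generate ?B ?H \<subseteq> perm ` Pow {..<n}"
  proof
    fix g assume "g \<in> generate ?B ?H"
    then show "g \<in> perm ` Pow {..<n}"
    proof (induction rule: generate.induct)
      case one
      show ?case by (simp add: perm_one)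
    next
      case (incl h)
      then show ?case by auto
    next
      case (inv h)
      then show ?case by (auto simp: perm_inv)
    next
      case (eng g h)
      then obtain S T where "g = perm S" "h = perm T" "S \<subseteq> {..<n}" "T \<subseteq> {..<n}"
        by auto
      then show ?case
        by (intro image_eqI[of _ _ "sym_diff S T"]) (auto simp: perm_mult)
    qed
  qed
  show "perm ` Pow {..<n} \<subseteq> generate ?B ?H"
  proof clarify
    fix S assume "S \<subseteq> {..<n}"
    then have "finite S"
      by (rule finite_subset) simp
    then show "perm S \<in> generate ?B ?H"
      using \<open>S \<subseteq> {..<n}\<close>
    proof (induction S)
      case empty
      show ?case
        using generate.one[of ?B ?H] by (simp add: perm_one)
    next
      case (insert i S)
      have "perm {i} \<otimes>\<^bsub>?B\<^esub> perm S \<in> generate ?B ?H"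
        using insert by (intro generate.eng generate.incl[of "perm {i}"]) auto
      moreover have "sym_diff {i} S = insert i S"
        using insert.hyps by auto
      ultimately show ?case
        by (simp add: perm_mult)
    qed
  qed
qed

lemma dynamics_group_eq:
  assumes "simple_update_order n \<pi>"
  shows "dynamics_group f n \<pi> = (BijGroup recurrent)\<lparr>carrier := perm ` Pow {..<n}\<rparr>"
proof -
  have "restrict (local_update f i) recurrent = perm {i}" if "i < n" for i
    using that by (auto simp: perm_def local_update_eq_toggle intro: restrict_ext)
  then have "(\<lambda>i. restrict (local_update f i) recurrent) ` {..<n} = (\<lambda>i. perm {i}) ` {..<n}"
    by (intro image_cong) simp_all
  then show ?thesis
    by (simp only: dynamics_group_def Let_def periodic_states_eq_recurrent[OF assms] generate_perm)
qed

lemma group_dynamics_group: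
  assumes "simple_update_order n \<pi>"
  shows "group (dynamics_group f n \<pi>)"
proof -
  have "(\<lambda>i. perm {i}) ` {..<n} \<subseteq> carrier (BijGroup recurrent)"
    using perm_in_Bij by (auto simp: BijGroup_def)
  then have "subgroup (perm ` Pow {..<n}) (BijGroup recurrent)"
    using group.generate_is_subgroup[OF group_BijGroup] generate_perm by metis
  then show ?thesis
    unfolding dynamics_group_eq[OF assms] using subgroup.subgroup_is_group group_BijGroup by blast
qed

text \<open>A loose position \<open>k\<close> has a 0 at \<open>k - 2\<close> and a 1 at \<open>k + 2\<close>, which is the same position if
  \<open>n = 4\<close>.\<close>

lemma trivial_dynamics_group:
  assumes "simple_update_order n \<pi>" and "n = 4"
  shows "trivial_group (dynamics_group f n \<pi>)"
proof -
  have "\<not> loose y k" if "length y = n" for y k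
  proof
    assume "loose y k"
    then have "bit_at y (k - 2) = 0" "bit_at y (k + 2) = 1"
      by (simp_all add: looseD)
    moreover have "bit_at y (k + 2) = bit_at y (k - 2)"
    proof (rule bit_at_cong)
      have "k + 2 = k - 2 + 4" by simp
      then show "(k + 2) mod int (length y) = (k - 2) mod int (length y)"
        using that assms(2) by (metis mod_add_self2 of_nat_numeral)
    qed
    ultimately show False by simp
  qed
  then have "perm S = perm {}" for S
    using length_recurrent
    by (auto simp: perm_def fun_eq_iff restrict_def toggle_no_loose)
  then have "perm ` Pow {..<n} = {perm {}}"
    by blast
  then show ?thesis
    using group_dynamics_group[OF assms(1)]
    by (simp add: trivial_group_def dynamics_group_eq[OF assms(1)] perm_one)
qed

text \<open>The state reads \<open>100\<close> around \<open>i\<close>; from there on it consists of \<open>10\<close> blocks, preceded by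
  one \<open>110\<close> if \<open>n\<close> is even.\<close>

lemma exists_loose_state:
  assumes "n > 4" and "i < n"
  shows "\<exists>y\<in>recurrent. loose y (int i)"
proof -
  define N where "N = int n"
  have N: "N \<ge> 5" using assms by (simp add: N_def)
  define b :: "int \<Rightarrow> bool" where "b d \<longleftrightarrow> d = 0 \<or> d = 3 \<or> d \<ge> 4 \<and> even (N - d)" for d
  define y where "y = map (\<lambda>j. of_bool (b ((int j - int i + 1) mod N)) :: bit) [0..<n]"
  have len: "length y = n" by (simp add: y_def)
  have bit: "bit_at y k = of_bool (b ((k - int i + 1) mod N))" for k
  proof -
    have "nat (k mod N) < n" "int (nat (k mod N)) = k mod N"
      using nat_mod_less[of n k] assms by (simp_all add: N_def)
    moreover have "(k mod N - int i + 1) mod N = (k - int i + 1) mod N"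
      by (metis add.commute mod_add_right_eq mod_diff_left_eq)
    ultimately show ?thesis
      by (simp add: bit_at_def len y_def flip: N_def)
  qed
  have bit_shift: "bit_at y (k + c) = of_bool (b (let e = (k - int i + 1) mod N + c in if e < N then e else e - N))"
    if "0 \<le> c" "c \<le> 3" for k c
  proof -
    define e where "e = (k - int i + 1) mod N + c"
    have e: "0 \<le> e" "e < 2 * N"
      using that N pos_mod_bound[of N "k - int i + 1"] pos_mod_sign[of N "k - int i + 1"]
      unfolding e_def by linarith+
    have "(k + c - int i + 1) mod N = e mod N"
    proof -
      have "k + c - int i + 1 = k - int i + 1 + c" by simp
      then show ?thesis
        unfolding e_def by (simp only: mod_add_left_eq)
    qed
    also have "e mod N = (if e < N then e else e - N)"
    proof (cases "e < N")
      case False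
      have "e mod N = (e - N) mod N" by simp
      also have "\<dots> = e - N"
        using False e by (intro mod_pos_pos_trivial) simp_all
      finally show ?thesis using False by simp
    qed (use e in simp)
    finally show ?thesis
      by (simp add: bit e_def Let_def)
  qed
  have "spaced y"
    unfolding spaced_def
  proof
    fix k
    define d where "d = (k - int i + 1) mod N"
    have d: "0 \<le> d" "d < N"
      using N by (simp_all add: d_def)
    have bits: "bit_at y k = of_bool (b d)"
      "bit_at y (k + 1) = of_bool (b (if d + 1 < N then d + 1 else d + 1 - N))"
      "bit_at y (k + 2) = of_bool (b (if d + 2 < N then d + 2 else d + 2 - N))"
      "bit_at y (k + 3) = of_bool (b (if d + 3 < N then d + 3 else d + 3 - N))"
      using bit[of k] bit_shift[of 1 k] bit_shift[of 2 k] bit_shift[of 3 k]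
      by (simp_all add: d_def Let_def)
    have rise: "k \<in> rises y \<longleftrightarrow> bit_at y k = 0 \<and> bit_at y (k + 1) = 1"
      "k + 1 \<in> rises y \<longleftrightarrow> bit_at y (k + 1) = 0 \<and> bit_at y (k + 2) = 1"
      "k + 2 \<in> rises y \<longleftrightarrow> bit_at y (k + 2) = 0 \<and> bit_at y (k + 3) = 1"
      by (simp_all add: rises_def add.assoc)
    consider "d = 0" | "d = 1" | "d = 2" | "d = 3" | "4 \<le> d" "d \<le> N - 4"
      | "4 \<le> d" "d = N - 3" | "4 \<le> d" "d = N - 2" | "4 \<le> d" "d = N - 1"
      using d by linarith
    then show "k \<in> rises y \<or> k + 1 \<in> rises y \<or> k + 2 \<in> rises y"
      unfolding rise by cases (use N in \<open>auto simp: bits b_def\<close>)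
  qed
  moreover have "loose y (int i)"
  proof -
    have "bit_at y (int i - 2) = of_bool (b (N - 1))" "bit_at y (int i - 1) = of_bool (b 0)"
      "bit_at y (int i + 1) = of_bool (b 2)" "bit_at y (int i + 2) = of_bool (b 3)"
      using N by (simp_all add: bit zmod_minus1)
    then show ?thesis
      using N by (simp add: loose_def rises_def b_def add.assoc)
  qed
  ultimately show ?thesis
    using len by (auto simp: recurrent_def states_def)
qed

text \<open>A state in which \<open>i\<close> is loose tells whether \<open>i\<close> is in the set.\<close>

lemma inj_on_perm:
  assumes "n > 4"
  shows "inj_on perm (Pow {..<n})"
proof (rule inj_onI)
  fix S T assume S: "S \<in> Pow {..<n}" and T: "T \<in> Pow {..<n}" and eq: "perm S = perm T"
  have "i \<in> S \<longleftrightarrow> i \<in> T" if i: "i < n" for i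
  proof -
    obtain y where y: "y \<in> recurrent" "loose y (int i)"
      using exists_loose_state[OF assms i] by blast
    then have "toggle S y = toggle T y"
      using eq by (metis perm_def restrict_apply')
    then have "bit_at (toggle S y) (int i) = bit_at (toggle T y) (int i)"
      by simp
    then show ?thesis
      using y(2) i length_recurrent[OF y(1)]
      by (cases "bit_at y (int i)") (auto simp: bit_at_toggle split: if_splits)
  qed
  then show "S = T"
    using S T by blast
qed

lemma dynamics_group_iso:
  assumes "simple_update_order n \<pi>" and "n > 4"
  shows "dynamics_group f n \<pi> \<cong> Z2_power n"
proof -
  define supp :: "(nat \<Rightarrow> int) \<Rightarrow> nat set" where "supp e = {i. i < n \<and> e i = 1}" for e
  have carrier: "carrier (Z2_power n) = (\<Pi>\<^sub>E i\<in>{..<n}. {0..<2})"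
    by (simp add: Z2_power_def carrier_integer_mod_group)
  have val: "e i = 0 \<or> e i = 1" if "e \<in> carrier (Z2_power n)" "i < n" for e i
  proof -
    have "e i \<in> {0..<2}"
      using that unfolding carrier by (metis PiE_mem lessThan_iff)
    then show ?thesis by auto
  qed
  have hom: "supp (d \<otimes>\<^bsub>Z2_power n\<^esub> e) = sym_diff (supp d) (supp e)"
    if "d \<in> carrier (Z2_power n)" "e \<in> carrier (Z2_power n)" for d e
  proof -
    have "(d \<otimes>\<^bsub>Z2_power n\<^esub> e) i = 1 \<longleftrightarrow> (d i = 1) \<noteq> (e i = 1)" if "i < n" for i
      using val[OF \<open>d \<in> _\<close> that] val[OF \<open>e \<in> _\<close> that] that by (auto simp: Z2_power_def)
    then show ?thesis
      by (auto simp: supp_def)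
  qed
  have "bij_betw supp (carrier (Z2_power n)) (Pow {..<n})"
  proof (rule bij_betw_byWitness[where f' = "\<lambda>S. \<lambda>i\<in>{..<n}. of_bool (i \<in> S)"])
    show "\<forall>e\<in>carrier (Z2_power n). (\<lambda>i\<in>{..<n}. of_bool (i \<in> supp e)) = e"
    proof
      fix e assume e: "e \<in> carrier (Z2_power n)"
      show "(\<lambda>i\<in>{..<n}. of_bool (i \<in> supp e)) = e"
      proof (rule extensionalityI)
        show "e \<in> extensional {..<n}"
          using e by (auto simp: carrier PiE_def)
        show "(\<lambda>i\<in>{..<n}. of_bool (i \<in> supp e)) i = e i" if "i \<in> {..<n}" for i
          using val[OF e, of i] that by (auto simp: supp_def)
      qed simp
    qed
    show "(\<lambda>S. \<lambda>i\<in>{..<n}. of_bool (i \<in> S)) ` Pow {..<n} \<subseteq> carrier (Z2_power n)"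
      unfolding carrier by (intro image_subsetI) (simp add: restrict_PiE_iff)
  qed (auto simp: supp_def)
  then have "bij_betw (perm \<circ> supp) (carrier (Z2_power n)) (perm ` Pow {..<n})"
    using inj_on_perm[OF assms(2)] by (meson bij_betw_imageI bij_betw_trans)
  moreover have "perm \<circ> supp \<in> hom (Z2_power n) (dynamics_group f n \<pi>)"
    unfolding dynamics_group_eq[OF assms(1)]
    by (intro homI) (auto simp: hom perm_mult, auto simp: supp_def)
  ultimately have "Z2_power n \<cong> dynamics_group f n \<pi>"
    by (auto simp: is_iso_def iso_def dynamics_group_eq[OF assms(1)])
  moreover have "group (Z2_power n)"
    by (simp add: Z2_power_def)
  ultimately show ?thesis
    by (rule group.iso_sym[rotated])
qed



section \<open>Counting orbits\<close>

definition representatives :: "bit list set" where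
  "representatives = {y \<in> recurrent. \<not> cyclic_subword word_A y}"

lemma recurrent_eq:
  "recurrent = avoiding n {word_B, word_C, word_F} \<union> (if f = rule28 then {replicate n 0} else {})"
proof -
  have "replicate n 0 \<in> states n"
    by (simp add: states_def)
  then show ?thesis
    using avoiding_BCF_eq[of n] n_gt_3 by (auto simp: recurrent_def)
qed

lemma zero_not_avoiding_B:
  assumes "word_B \<in> W"
  shows "replicate n 0 \<notin> avoiding n W"
proof -
  have "cyclic_subword word_B (replicate n 0)"
    using n_gt_3 by (simp add: cyclic_subword_iff nth_Cons split: nat.split)
  then show ?thesis
    using assms by (auto simp: avoiding_def)
qed

lemma representatives_eq:
  "representatives = avoiding n {word_A, word_B} \<union> (if f = rule28 then {replicate n 0} else {})"
proof -
  have "\<not> cyclic_subword word_C y" "\<not> cyclic_subword word_F y" if "\<not> cyclic_subword word_A y" for y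
    using that cyclic_subword_prefix[of word_A "[1]" y] cyclic_subword_prefix[of word_A "[0, 0]" y]
    by auto
  then have "avoiding n {word_A, word_B} =
      {y \<in> avoiding n {word_B, word_C, word_F}. \<not> cyclic_subword word_A y}"
    by (auto simp: avoiding_def)
  moreover have "\<not> cyclic_subword word_A (replicate n 0)"
    using n_gt_3 by (simp add: not_cyclic_subword_A_iff)
  ultimately show ?thesis
    by (auto simp: representatives_def recurrent_eq)
qed

lemma orbit_eq:
  assumes "simple_update_order n \<pi>" and "y \<in> recurrent"
  shows "orbit (dynamics_group f n \<pi>) (\<lambda>g. g) y = {toggle S y | S. S \<subseteq> {..<n}}"
proof -
  have "orbit (dynamics_group f n \<pi>) (\<lambda>g. g) y = {perm S y | S. S \<subseteq> {..<n}}"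
    by (auto simp: orbit_def dynamics_group_eq[OF assms(1)])
  then show ?thesis
    using assms(2) by (simp add: perm_def)
qed

text \<open>Two representatives in one orbit have the same rises, hence are equal. Conversely, toggling
  the second 1 of every \<open>11\<close> leads from any state to a representative: such a 1 is loose, since
  gaps have width at most 3.\<close>

lemma num_orbits_eq_card_representatives:
  assumes "simple_update_order n \<pi>"
  shows "num_orbits f n \<pi> = card representatives"
proof -
  define orb where "orb y = {toggle S y | S. S \<subseteq> {..<n}}" for y
  have orb_toggle: "orb (toggle T y) = orb y" if "y \<in> recurrent" "T \<subseteq> {..<n}" for T y
  proof -
    have "orb (toggle T x) \<subseteq> orb x" if "x \<in> recurrent" for x
    proof
      fix w assume "w \<in> orb (toggle T x)"
      then obtain S where S: "S \<subseteq> {..<n}" "w = toggle S (toggle T x)"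
        by (auto simp: orb_def)
      then have "w = toggle (sym_diff S T) x"
        using toggle_toggle length_recurrent[OF that] by simp
      moreover have "sym_diff S T \<subseteq> {..<n}"
        using S(1) \<open>T \<subseteq> {..<n}\<close> by blast
      ultimately show "w \<in> orb x"
        unfolding orb_def by blast
    qed
    from this[OF that(1)] this[OF toggle_recurrent[OF that(1), of T]] show ?thesis
      using length_recurrent[OF that(1)] by (simp add: toggle_toggle)
  qed
  have "inj_on orb representatives"
  proof (rule inj_onI)
    fix y z assume yz: "y \<in> representatives" "z \<in> representatives" and eq: "orb y = orb z"
    have len: "length y = n" "length z = n" "n > 0"
      using yz length_recurrent n_gt_3 by (auto simp: representatives_def)
    have "toggle {} y \<in> orb y"
      unfolding orb_def by blast
    then obtain S where "y = toggle S z"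
      unfolding eq by (auto simp: orb_def)
    then have "rises y = rises z"
      using len by simp
    then show "y = z"
      using yz len by (intro eq_if_rises_eq_no_A) (auto simp: representatives_def)
  qed
  moreover have "orb ` representatives = orb ` recurrent"
  proof
    show "orb ` recurrent \<subseteq> orb ` representatives"
    proof clarify
      fix y assume y: "y \<in> recurrent"
      have len: "length y = n" "n > 0"
        using length_recurrent[OF y] by auto
      define S where "S = {i. i < n \<and> bit_at y (int i - 1) = 1 \<and> bit_at y (int i) = 1}"
      define z where "z = toggle S y"
      have z: "z \<in> recurrent"
        using y by (simp add: z_def toggle_recurrent)
      have mem: "nat (k mod int n) \<in> S \<longleftrightarrow> bit_at y (k - 1) = 1 \<and> bit_at y k = 1" for k
      proof -
        let ?i = "nat (k mod int n)"
        have i: "?i < n" "int ?i = k mod int n"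
          using nat_mod_less len by simp_all
        then have "bit_at y (int ?i) = bit_at y k" "bit_at y (int ?i - 1) = bit_at y (k - 1)"
          using len mod_diff_left_eq[of k "int n" 1] by (auto intro!: bit_at_cong)
        then show ?thesis
          using i(1) by (simp add: S_def)
      qed
      have loose: "loose y k" if "bit_at y (k - 1) = 1" "bit_at y k = 1" for k
      proof -
        have "y \<noteq> replicate n 0"
          using that(2) len(2) bit_at_replicate[of n 0 k] zero_neq_one by metis
        then have "spaced y"
          using y by (simp add: recurrent_def)
        then have "k - 2 \<in> rises y \<or> k - 1 \<in> rises y \<or> k \<in> rises y"
          "k - 1 \<in> rises y \<or> k \<in> rises y \<or> k + 1 \<in> rises y"
          using spaced_def[of y, THEN iffD1, rule_format, of "k - 2"]
            spaced_def[of y, THEN iffD1, rule_format, of "k - 1"] by (simp_all add: add.commute)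
        moreover have "k - 1 \<notin> rises y" "k \<notin> rises y"
          using that by (simp_all add: rises_def)
        ultimately show ?thesis
          by (simp add: loose_def)
      qed
      have bit: "bit_at z k = (if bit_at y (k - 1) = 1 then 0 else bit_at y k)" for k
        using mem[of k] loose[of k] len by (cases "bit_at y k") (auto simp: z_def bit_at_toggle)
      have "length z > 0"
        using len by (simp add: z_def)
      then have "\<not> cyclic_subword word_A z"
        by (subst not_cyclic_subword_A_iff) (auto simp: bit)
      then have "z \<in> representatives"
        using z by (simp add: representatives_def)
      moreover have "orb z = orb y"
        unfolding z_def using y by (intro orb_toggle) (auto simp: S_def)
      ultimately show "orb y \<in> orb ` representatives"
        by blast
    qed
  qed (auto simp: representatives_def)
  moreover have "orbits (dynamics_group f n \<pi>) recurrent (\<lambda>g. g) = orb ` recurrent"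
    unfolding orbits_def Setcompr_eq_image
    by (rule image_cong) (simp_all add: orbit_eq[OF assms] orb_def)
  then have "num_orbits f n \<pi> = card (orb ` recurrent)"
    by (simp add: num_orbits_def periodic_states_eq_recurrent[OF assms])
  ultimately show ?thesis
    by (metis card_image)
qed

lemma finite_avoiding: "finite (avoiding n W)"
proof (rule finite_subset)
  show "avoiding n W \<subseteq> {y. set y \<subseteq> {0, 1} \<and> length y = n}"
    by (auto simp: avoiding_def states_def)
qed (simp add: finite_lists_length_eq)

lemma num_orbits_eq:
  assumes "simple_update_order n \<pi>"
  shows "num_orbits f n \<pi> = card (avoiding n {word_A, word_B}) + (if f = rule28 then 1 else 0)"
  using finite_avoiding zero_not_avoiding_B
  by (simp add: num_orbits_eq_card_representatives[OF assms] representatives_eq)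

end

lemma rule28_neq_rule29: "rule29 \<noteq> rule28"
proof
  assume "rule29 = rule28"
  then have "rule29 0 0 0 = rule28 0 0 0" by simp
  then show False by (simp add: rule28_def rule29_def)
qed

theorem mainTheorem9:
  fixes n :: nat and \<pi> :: "nat list"
  assumes "n > 3" and "simple_update_order n \<pi>"
  shows "periodic_states rule28 n \<pi> = avoiding n {word_B, word_C, word_F} \<union> {replicate n 0}
    \<and> periodic_states rule29 n \<pi> = avoiding n {word_B, word_C, word_F}
    \<and> num_orbits rule28 n \<pi> = card (avoiding n {word_A, word_B}) + 1
    \<and> num_orbits rule29 n \<pi> = card (avoiding n {word_A, word_B})
    \<and> (n > 4 \<longrightarrow> dynamics_group rule28 n \<pi> \<cong> Z2_power n \<and> dynamics_group rule29 n \<pi> \<cong> Z2_power n)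
    \<and> (n = 4 \<longrightarrow> trivial_group (dynamics_group rule28 n \<pi>) \<and> trivial_group (dynamics_group rule29 n \<pi>))"
proof -
  interpret r28: rule_28_or_29 rule28 n
    by standard (use assms in auto)
  interpret r29: rule_28_or_29 rule29 n
    by standard (use assms in auto)
  show ?thesis
    using r28.periodic_states_eq_recurrent[OF assms(2)] r29.periodic_states_eq_recurrent[OF assms(2)]
      r28.num_orbits_eq[OF assms(2)] r29.num_orbits_eq[OF assms(2)]
      r28.dynamics_group_iso[OF assms(2)] r29.dynamics_group_iso[OF assms(2)]
      r28.trivial_dynamics_group[OF assms(2)] r29.trivial_dynamics_group[OF assms(2)]
    by (simp add: r28.recurrent_eq r29.recurrent_eq rule28_neq_rule29)
qed

end
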